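(* Let $\mathcal{G}$ be a hereditary class of graphs. If every blowup of every prime graph in $\mathcal{G}$ is recolorable, then every graph in $\mathcal{G}$ is recolorable.
   Context: Graphs are finite and simple. A class of graphs is hereditary if it is closed under taking induced subgraphs. A $k$-coloring of $G$ is a map $V(G)\to\{1,\dots,k\}$ giving adjacent vertices different colors; $\chi(G)$ is the least $k$ for which one exists. $R_k(G)$ is the graph whose vertices are the $k$-colorings of $G$, two being adjacent if they differ on exactly one vertex. $G$ is $k$-mixing if $R_k(G)$ is connected, and $G$ is recolorable if $G$ is $\ell$-mixing for every $\ell\ge\chi(G)+1$. A module of $G$ is a non-empty $S\subseteq V(G)$ such that every vertex outside $S$ is adjacent to all or none of $S$; it is non-trivial if it is a proper subset of $V(G)$ with at least two vertices; $G$ is prime if it has no non-trivial module. A blowup of a graph $G$ is a graph obtained from $G$ by substituting non-empty cliques for some of its vertices (substituting a clique $K$ for a vertex $v$ means deleting $v$ and adding $K$ with every vertex of $K$ adjacent to every former neighbor of $v$). *)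

theory Defs
  imports
    "Graph_Theory.Graph_Theory"
    "HOL-Library.FuncSet"
    "HOL-Library.Infinite_Typeclass"
begin

text \<open>
  Finite simple graphs are the \<^locale>\<open>pair_graph\<close>s of the library: finite, loop-free,
  symmetric digraphs, so an edge \<open>uv\<close> is present as both arcs \<open>(u, v)\<close> and \<open>(v, u)\<close>.
  The graph without vertices is allowed.
\<close>

text \<open>
  A class of graphs is a set of graphs with vertices in a fixed type. It is not required to be
  closed under isomorphism. Taking the vertex type infinite provides a copy of every finite graph
  and fresh vertices for every blowup.
\<close>
definition hereditary :: "'a pair_pre_digraph set \<Rightarrow> bool" where
  "hereditary \<G> \<longleftrightarrow>
     (\<forall>G\<in>\<G>. \<forall>H. induced_subgraph (with_proj H) (with_proj G) \<longrightarrow> H \<in> \<G>)"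

definition colorings :: "'a pair_pre_digraph \<Rightarrow> nat \<Rightarrow> ('a \<Rightarrow> nat) set" where
  "colorings G k = {c \<in> pverts G \<rightarrow>\<^sub>E {1..k}. \<forall>(u, v)\<in>parcs G. c u \<noteq> c v}"

definition chromatic_number :: "'a pair_pre_digraph \<Rightarrow> nat" where
  "chromatic_number G = (LEAST k. colorings G k \<noteq> {})"

definition recoloring_graph :: "'a pair_pre_digraph \<Rightarrow> nat \<Rightarrow> ('a \<Rightarrow> nat) pair_pre_digraph" where
  "recoloring_graph G k =
     \<lparr> pverts = colorings G k,
       parcs = {(c, d). c \<in> colorings G k \<and> d \<in> colorings G k \<and>
                        (\<exists>!v. v \<in> pverts G \<and> c v \<noteq> d v)} \<rparr>"

text \<open>
  \<^const>\<open>connected\<close> demands at least one vertex; for \<open>k \<ge> chromatic_number G\<close> there is one.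
\<close>
definition mixing :: "'a pair_pre_digraph \<Rightarrow> nat \<Rightarrow> bool" where
  "mixing G k \<longleftrightarrow> connected (with_proj (recoloring_graph G k))"

definition recolorable :: "'a pair_pre_digraph \<Rightarrow> bool" where
  "recolorable G \<longleftrightarrow> (\<forall>l \<ge> chromatic_number G + 1. mixing G l)"

definition graph_module :: "'a pair_pre_digraph \<Rightarrow> 'a set \<Rightarrow> bool" where
  "graph_module G S \<longleftrightarrow> S \<noteq> {} \<and> S \<subseteq> pverts G \<and>
     (\<forall>v \<in> pverts G - S. (\<forall>s\<in>S. (v, s) \<in> parcs G) \<or> (\<forall>s\<in>S. (v, s) \<notin> parcs G))"

definition nontrivial_module :: "'a pair_pre_digraph \<Rightarrow> 'a set \<Rightarrow> bool" where
  "nontrivial_module G S \<longleftrightarrow> graph_module G S \<and> S \<subset> pverts G \<and> card S \<ge> 2"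

definition prime_graph :: "'a pair_pre_digraph \<Rightarrow> bool" where
  "prime_graph G \<longleftrightarrow> (\<nexists>S. nontrivial_module G S)"

definition substitute_clique :: "'a pair_pre_digraph \<Rightarrow> 'a \<Rightarrow> 'a set \<Rightarrow> 'a pair_pre_digraph" where
  "substitute_clique G v K =
     \<lparr> pverts = (pverts G - {v}) \<union> K,
       parcs = {(x, y). (x, y) \<in> parcs G \<and> x \<noteq> v \<and> y \<noteq> v}
             \<union> {(x, y). x \<in> K \<and> y \<in> K \<and> x \<noteq> y}
             \<union> {(x, y). x \<in> K \<and> y \<noteq> v \<and> (v, y) \<in> parcs G}
             \<union> {(x, y). y \<in> K \<and> x \<noteq> v \<and> (x, v) \<in> parcs G} \<rparr>"

text \<open>
  \<open>blowup G H\<close>: \<open>H\<close> is a blowup of \<open>G\<close>, built by substituting one clique at a time. A clique must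
  be disjoint from the remaining vertices but may reuse the name of the vertex it replaces.
  Substituting a clique for a vertex of an already substituted clique is permitted; it merely
  resizes that clique.
\<close>
inductive blowup :: "'a pair_pre_digraph \<Rightarrow> 'a pair_pre_digraph \<Rightarrow> bool" for G where
  refl: "blowup G G"
| substitute: "\<lbrakk>blowup G H; v \<in> pverts H; finite K; K \<noteq> {}; K \<inter> (pverts H - {v}) = {}\<rbrakk>
    \<Longrightarrow> blowup G (substitute_clique H v K)"

end

(*
  Induct on the number of vertices of G to show that every graph obtained from a member G of the
  class by substituting cliques for its vertices is recolorable. If G is prime, this is a blowup of
  G. Otherwise G has a non-trivial module, whose expansion M is a module of the expanded graph H.
  Both H[M] and the graph H' that arises from H by shrinking M to a clique with chi(H[M]) vertices
  are expansions of smaller members of the class. A coloring of H that uses exactly chi(H[M]) colors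
  on M is the lift of a coloring of H', so it can be moved within H' to a coloring avoiding some
  color; with a spare color on M, the mixing of H[M] rearranges M into a fixed partition, after
  which the mixing of H' leads to a fixed target coloring.
*)
theory Submission
  imports Defs
begin

section \<open>Simple graphs and their induced subgraphs\<close>

lemma pair_graph_iff:
  "pair_graph G \<longleftrightarrow> finite (pverts G) \<and> parcs G \<subseteq> pverts G \<times> pverts G \<and> sym (parcs G) \<and> irrefl (parcs G)"
proof
  assume "pair_graph G"
  then interpret pair_graph G .
  show "finite (pverts G) \<and> parcs G \<subseteq> pverts G \<times> pverts G \<and> sym (parcs G) \<and> irrefl (parcs G)"
    using pair_finite_verts arcs_symmetric wellformed'
    by (auto simp: irrefl_def intro!: symI dest: no_loops')
next
  assume *: "finite (pverts G) \<and> parcs G \<subseteq> pverts G \<times> pverts G \<and> sym (parcs G) \<and> irrefl (parcs G)"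
  then have "finite (parcs G)"
    by (meson finite_SigmaI finite_subset)
  with * show "pair_graph G"
    by unfold_locales (auto simp: irrefl_def symmetric_def)
qed

lemma
  assumes "pair_graph G"
  shows pair_graph_finite: "finite (pverts G)"
    and pair_graph_wf: "(u, v) \<in> parcs G \<Longrightarrow> u \<in> pverts G \<and> v \<in> pverts G"
    and pair_graph_sym: "(u, v) \<in> parcs G \<Longrightarrow> (v, u) \<in> parcs G"
    and pair_graph_irrefl: "(u, v) \<in> parcs G \<Longrightarrow> u \<noteq> v"
  using assms by (auto simp: pair_graph_iff irrefl_def dest: symD)

definition induced :: "'a pair_pre_digraph \<Rightarrow> 'a set \<Rightarrow> 'a pair_pre_digraph" where
  "induced G S = \<lparr> pverts = S, parcs = parcs G \<inter> S \<times> S \<rparr>"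

lemma induced_simps [simp]:
  "pverts (induced G S) = S"
  "parcs (induced G S) = parcs G \<inter> S \<times> S"
  by (simp_all add: induced_def)

lemma pair_graph_induced:
  "pair_graph G \<Longrightarrow> S \<subseteq> pverts G \<Longrightarrow> pair_graph (induced G S)"
  by (auto simp: pair_graph_iff irrefl_def sym_def intro: finite_subset)

lemma hereditary_induced:
  assumes "hereditary \<G>" "G \<in> \<G>" "pair_graph G" "S \<subseteq> pverts G"
  shows "induced G S \<in> \<G>"
proof -
  interpret G: pair_graph G by fact
  interpret I: pair_graph "induced G S" by (rule pair_graph_induced) fact+
  have "induced_subgraph (with_proj (induced G S)) (with_proj G)"
    using assms(4) G.wf_digraph I.wf_digraph
    by (auto simp: induced_subgraph_def subgraph_def compatible_def)
  then show ?thesis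
    using assms(1,2) by (auto simp: hereditary_def)
qed

section \<open>Colorings and recoloring sequences\<close>

lemma colorings_iff:
  "c \<in> colorings G k \<longleftrightarrow> (\<forall>x\<in>pverts G. c x \<in> {1..k}) \<and> (\<forall>x. x \<notin> pverts G \<longrightarrow> c x = undefined) \<and>
     (\<forall>u v. (u, v) \<in> parcs G \<longrightarrow> c u \<noteq> c v)"
  by (auto simp: colorings_def PiE_iff extensional_def)

text \<open>Renumbering the values of \<open>f\<close> along a bijection \<open>h\<close> onto an
  initial segment of the numbers turns any proper labeling, with labels of any type, into a
  coloring; outside the graph it is reset to \<open>undefined\<close>.\<close>

lemma colorings_card_image:
  assumes "pair_graph G" and proper: "\<And>u v. (u, v) \<in> parcs G \<Longrightarrow> f u \<noteq> f v"
  shows "colorings G (card (f ` pverts G)) \<noteq> {}"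
proof -
  let ?A = "f ` pverts G"
  have "finite ?A"
    using assms(1) by (simp add: pair_graph_finite)
  then obtain h where h: "bij_betw h ?A {1..card ?A}"
    using finite_same_card_bij[of ?A "{1..card ?A}"] by auto
  have "(\<lambda>x. if x \<in> pverts G then h (f x) else undefined) \<in> colorings G (card ?A)"
    unfolding colorings_iff
  proof (intro conjI allI impI ballI)
    fix u v assume "(u, v) \<in> parcs G"
    with proper[OF this] pair_graph_wf[OF assms(1) this] h
    show "(if u \<in> pverts G then h (f u) else undefined) \<noteq>
        (if v \<in> pverts G then h (f v) else undefined)"
      by (auto simp: bij_betw_def inj_on_def)
  qed (use bij_betwE[OF h] in auto)
  then show ?thesis by blast
qed

lemma chromatic_number_le_card_image:
  assumes "pair_graph G" "\<And>u v. (u, v) \<in> parcs G \<Longrightarrow> f u \<noteq> f v"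
  shows "chromatic_number G \<le> card (f ` pverts G)"
  unfolding chromatic_number_def by (rule Least_le, rule colorings_card_image) (use assms in auto)

lemma chromatic_number_le: "colorings G k \<noteq> {} \<Longrightarrow> chromatic_number G \<le> k"
  unfolding chromatic_number_def by (rule Least_le)

text \<open>Using every vertex as its own color is proper, so the minimum in
  \<open>chromatic_number\<close> is taken over a non-empty set.\<close>

lemma colorings_chromatic_number:
  assumes "pair_graph G"
  shows "colorings G (chromatic_number G) \<noteq> {}"
  unfolding chromatic_number_def
  by (rule LeastI, rule colorings_card_image[where f = "\<lambda>x. x"])
    (use assms pair_graph_irrefl[OF assms] in auto)

lemma colorings_mono: "k \<le> l \<Longrightarrow> colorings G k \<subseteq> colorings G l"
  by (fastforce simp: colorings_iff)

abbreviation recolor :: "'a pair_pre_digraph \<Rightarrow> nat \<Rightarrow> ('a \<Rightarrow> nat) rel" where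
  "recolor G k \<equiv> parcs (recoloring_graph G k)"

lemma recolor_iff:
  "(c, d) \<in> recolor G k \<longleftrightarrow> c \<in> colorings G k \<and> d \<in> colorings G k \<and>
     (\<exists>!v. v \<in> pverts G \<and> c v \<noteq> d v)"
  by (simp add: recoloring_graph_def)

lemma sym_recolor: "sym (recolor G k)"
  by (auto simp: sym_def recolor_iff eq_commute)

text \<open>\<open>connected\<close> speaks of paths in the symmetric closure that stay inside the
  vertex set. As \<open>recolor\<close> is symmetric and relates only colorings, its plain reflexive
  transitive closure describes the same paths.\<close>

lemma mixing_iff:
  "mixing G k \<longleftrightarrow> colorings G k \<noteq> {} \<and>
     (\<forall>c\<in>colorings G k. \<forall>d\<in>colorings G k. (c, d) \<in> (recolor G k)\<^sup>*)"
proof -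
  let ?R = "recoloring_graph G k"
  have verts: "pverts ?R = colorings G k"
    by (simp add: recoloring_graph_def)
  have "parcs (mk_symmetric (with_proj ?R)) = parcs ?R"
    using sym_recolor[of G k] by (auto simp: parcs_mk_symmetric dest: symD)
  moreover have "(c, d) \<in> rtrancl_on (colorings G k) (recolor G k) \<longleftrightarrow> (c, d) \<in> (recolor G k)\<^sup>*"
    if "c \<in> colorings G k" "d \<in> colorings G k" for c d
    using rtrancl_on_rtranclI[of c d] rtrancl_consistent_rtrancl_on[of c d] that
    by (metis recolor_iff)
  ultimately show ?thesis
    by (auto simp: mixing_def connected_def strongly_connected_def reachable_def verts)
qed

text \<open>The vertices on which \<open>c\<close> and \<open>d\<close> disagree are pairwise
  non-adjacent, so they can be recolored one by one in any order: all neighbors of such a vertex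
  already have their final color.\<close>

lemma recolor_independent:
  assumes G: "pair_graph G" and d: "d \<in> colorings G k"
    and c: "c \<in> colorings G k"
    and indep: "\<And>u v. (u, v) \<in> parcs G \<Longrightarrow> c u \<noteq> d u \<Longrightarrow> c v = d v"
  shows "(c, d) \<in> (recolor G k)\<^sup>*"
  using c indep
proof (induction "card {x. c x \<noteq> d x}" arbitrary: c)
  case 0
  \<comment> \<open>Cardinality 0 alone would allow an infinite set. Both colorings are
    \<open>undefined\<close> outside the graph, which makes the set finite and hence empty.\<close>
  have "{x. c x \<noteq> d x} \<subseteq> pverts G"
    using 0(2) d unfolding colorings_iff by (metis (mono_tags, lifting) mem_Collect_eq subsetI)
  then have "finite {x. c x \<noteq> d x}"
    using pair_graph_finite[OF G] finite_subset by blast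
  with 0 have "c = d" by auto
  then show ?case by simp
next
  case (Suc n)
  then obtain v where v: "c v \<noteq> d v"
    by fastforce
  with Suc(3) d have vG: "v \<in> pverts G"
    by (metis colorings_iff)
  let ?c = "c(v := d v)"
  have "{x. c x \<noteq> d x} = insert v {x. ?c x \<noteq> d x}"
    using v by auto
  moreover have "x \<in> pverts G" if "c x \<noteq> d x" for x
    using Suc(3) d that by (metis colorings_iff)
  then have "finite {x. ?c x \<noteq> d x}"
    by (intro finite_subset[OF _ pair_graph_finite[OF G]]) auto
  ultimately have n: "n = card {x. ?c x \<noteq> d x}"
    using Suc(2) by simp
  have nb: "c u = d u \<and> d u \<noteq> d v" if "(v, u) \<in> parcs G" for u
    using Suc(4)[OF that v] d that by (metis colorings_iff)
  have col: "?c \<in> colorings G k"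
    using Suc(3) d vG nb pair_graph_sym[OF G] pair_graph_irrefl[OF G]
    unfolding colorings_iff fun_upd_apply by (smt (verit))
  have "(c, ?c) \<in> recolor G k"
    using Suc(3) col v vG by (auto simp: recolor_iff)
  moreover have "(?c, d) \<in> (recolor G k)\<^sup>*"
    using n col by (rule Suc(1)) (use Suc(4) in \<open>auto split: if_splits\<close>)
  ultimately show ?case by (rule converse_rtrancl_into_rtrancl)
qed

lemma rtrancl_map:
  assumes "(x, y) \<in> r\<^sup>*" "\<And>x y. (x, y) \<in> r \<Longrightarrow> (f x, f y) \<in> s\<^sup>*"
  shows "(f x, f y) \<in> s\<^sup>*"
  using assms(1) by induction (auto intro: rtrancl_trans assms(2))

text \<open>A homomorphism that also sends non-vertices to non-vertices. This way a coloring pulled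
  back along \<open>r\<close> is still \<open>undefined\<close> outside \<open>G\<close>.\<close>

locale graph_hom =
  fixes G H :: "'a pair_pre_digraph" and r :: "'a \<Rightarrow> 'a"
  assumes G: "pair_graph G" and H: "pair_graph H"
    and hom: "(u, v) \<in> parcs G \<Longrightarrow> (r u, r v) \<in> parcs H"
    and verts: "r x \<in> pverts H \<longleftrightarrow> x \<in> pverts G"
begin

lemma colorings_comp: "p \<in> colorings H k \<Longrightarrow> p \<circ> r \<in> colorings G k"
  using hom verts by (simp add: colorings_iff)

text \<open>One recoloring step in \<open>H\<close> recolors a fiber of \<open>r\<close>, which is an independent set.\<close>
lemma recolor_comp:
  assumes "(p, q) \<in> (recolor H k)\<^sup>*"
  shows "(p \<circ> r, q \<circ> r) \<in> (recolor G k)\<^sup>*"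
  using assms
proof (rule rtrancl_map)
  fix p q assume pq: "(p, q) \<in> recolor H k"
  show "(p \<circ> r, q \<circ> r) \<in> (recolor G k)\<^sup>*"
  proof (rule recolor_independent[OF G])
    fix u v assume uv: "(u, v) \<in> parcs G" and "(p \<circ> r) u \<noteq> (q \<circ> r) u"
    moreover have "r u \<in> pverts H" "r v \<in> pverts H" "r u \<noteq> r v"
      using hom[OF uv] pair_graph_wf[OF H] pair_graph_irrefl[OF H] by blast+
    ultimately show "(p \<circ> r) v = (q \<circ> r) v"
      using pq by (auto simp: recolor_iff)
  qed (use pq in \<open>auto simp: recolor_iff colorings_comp\<close>)
qed

end

section \<open>Contracting a module to a clique\<close>

text \<open>Meant for \<open>K\<close> inside a module \<open>M\<close>: the edges between
  \<open>K\<close> and the outside are inherited from \<open>G\<close>, and only those within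
  \<open>K\<close> are added.\<close>

definition replace_module :: "'a pair_pre_digraph \<Rightarrow> 'a set \<Rightarrow> 'a set \<Rightarrow> 'a pair_pre_digraph" where
  "replace_module G M K =
     \<lparr> pverts = (pverts G - M) \<union> K,
       parcs = parcs G \<inter> ((pverts G - M) \<union> K) \<times> ((pverts G - M) \<union> K) \<union> (K \<times> K - Id) \<rparr>"

lemma replace_module_simps [simp]:
  "pverts (replace_module G M K) = (pverts G - M) \<union> K"
  "parcs (replace_module G M K) =
     parcs G \<inter> ((pverts G - M) \<union> K) \<times> ((pverts G - M) \<union> K) \<union> (K \<times> K - Id)"
  by (simp_all add: replace_module_def)

text \<open>The vertices of \<open>K\<close> stand for the color classes of an optimal coloring of
  H[M]. There is room for them in \<open>M\<close>, since chi(H[M]) is at most the size of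
  \<open>M\<close>.\<close>

locale clique_contraction =
  fixes H :: "'a pair_pre_digraph" and M K :: "'a set"
  assumes H: "pair_graph H" and module: "graph_module H M"
    and KM: "K \<subseteq> M" and card_K: "card K = chromatic_number (induced H M)"
begin

abbreviation "H' \<equiv> replace_module H M K"

lemma M_subset: "M \<subseteq> pverts H"
  using module by (simp add: graph_module_def)

lemma finite_M: "finite M" and finite_K: "finite K"
  using finite_subset[OF M_subset] finite_subset[OF KM] pair_graph_finite[OF H] by auto

lemma module_arc:
  "(u, v) \<in> parcs H \<Longrightarrow> u \<notin> M \<Longrightarrow> v \<in> M \<Longrightarrow> w \<in> M \<Longrightarrow> (u, w) \<in> parcs H"
  using module pair_graph_wf[OF H, of u v] by (auto simp: graph_module_def)

lemma module_arc':
  "(v, u) \<in> parcs H \<Longrightarrow> u \<notin> M \<Longrightarrow> v \<in> M \<Longrightarrow> w \<in> M \<Longrightarrow> (w, u) \<in> parcs H"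
  using module_arc pair_graph_sym[OF H] by blast

lemma H': "pair_graph H'"
  using H KM M_subset finite_K by (auto simp: pair_graph_iff irrefl_def sym_def)

lemma induced_M: "pair_graph (induced H M)"
  using H M_subset by (rule pair_graph_induced)

lemma chromatic_number_le_card_colors:
  "c \<in> colorings H k \<Longrightarrow> card K \<le> card (c ` M)"
  using chromatic_number_le_card_image[OF induced_M, of c] by (auto simp: card_K colorings_iff)

text \<open>Retracts \<open>M\<close> onto \<open>K\<close> along a proper coloring \<open>\<phi>\<close> of \<open>M\<close> with color set \<open>K\<close>.\<close>
definition retract :: "('a \<Rightarrow> 'a) \<Rightarrow> 'a \<Rightarrow> 'a" where
  "retract \<phi> x = (if x \<in> M then \<phi> x else x)"

text \<open>An edge within \<open>M\<close> goes to two distinct vertices of the clique. An edge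
  leaving \<open>M\<close> has its inner end moved within \<open>M\<close>, which preserves it
  because \<open>M\<close> is a module.\<close>

lemma graph_hom_retract:
  assumes "\<phi> ` M \<subseteq> K" and "\<And>u v. (u, v) \<in> parcs H \<Longrightarrow> u \<in> M \<Longrightarrow> v \<in> M \<Longrightarrow> \<phi> u \<noteq> \<phi> v"
  shows "graph_hom H H' (retract \<phi>)"
proof (rule graph_hom.intro)
  fix u v assume uv: "(u, v) \<in> parcs H"
  have "\<phi> x \<in> K" "\<phi> x \<in> M" if "x \<in> M" for x
    using that assms(1) KM by auto
  then show "(retract \<phi> u, retract \<phi> v) \<in> parcs H'"
    using uv assms(2)[OF uv] pair_graph_wf[OF H uv] module_arc[OF uv] module_arc'[OF uv]
    by (auto simp: retract_def)
next
  fix x show "retract \<phi> x \<in> pverts H' \<longleftrightarrow> x \<in> pverts H"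
    using assms(1) KM M_subset by (auto simp: retract_def)
qed (rule H H')+

definition contract :: "('a \<Rightarrow> nat) \<Rightarrow> ('a \<Rightarrow> nat) \<Rightarrow> 'a \<Rightarrow> nat" where
  "contract e c x = (if x \<in> K then e x else if x \<in> M then undefined else c x)"

text \<open>Injectivity of \<open>e\<close> takes care of the clique, and \<open>free\<close> keeps
  the colors of the clique away from the outside neighbors of \<open>M\<close>. All other edges are
  colored as by \<open>c\<close>.\<close>

lemma contract_colorings:
  assumes c: "c \<in> colorings H k" and e: "inj_on e K" "e ` K \<subseteq> {1..k}"
    and free: "\<And>u v. (u, v) \<in> parcs H \<Longrightarrow> u \<notin> M \<Longrightarrow> v \<in> M \<Longrightarrow> c u \<notin> e ` K"
  shows "contract e c \<in> colorings H' k"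
  unfolding colorings_iff
proof (intro conjI allI impI ballI)
  fix u v assume uv: "(u, v) \<in> parcs H'"
  consider "u \<in> K" "v \<in> K" "u \<noteq> v" | "(u, v) \<in> parcs H" "u \<in> K" "v \<notin> M"
    | "(v, u) \<in> parcs H" "v \<in> K" "u \<notin> M" | "(u, v) \<in> parcs H" "u \<notin> M" "v \<notin> M"
  proof -
    have "u \<noteq> v" by (rule pair_graph_irrefl[OF H' uv])
    moreover have "u \<in> K \<and> v \<in> K \<or>
        (u, v) \<in> parcs H \<and> (u \<in> K \<or> u \<notin> M) \<and> (v \<in> K \<or> v \<notin> M)"
      using uv by simp blast
    ultimately show ?thesis
      using that pair_graph_sym[OF H, of u v] by blast
  qed
  then show "contract e c u \<noteq> contract e c v"
  proof cases
    case 1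
    then show ?thesis using e by (auto simp: contract_def inj_on_def)
  next
    case 2
    with free[of v u] KM pair_graph_sym[OF H] have "c v \<notin> e ` K" by blast
    with 2 KM show ?thesis by (auto simp: contract_def image_iff)
  next
    case 3
    with free[of u v] KM pair_graph_sym[OF H] have "c u \<notin> e ` K" by blast
    with 3 KM show ?thesis by (auto simp: contract_def image_iff)
  next
    case 4
    with c KM show ?thesis by (auto simp: contract_def colorings_iff)
  qed
next
  fix x assume "x \<in> pverts H'"
  then show "contract e c x \<in> {1..k}"
    using c e KM by (fastforce simp: contract_def colorings_iff)
next
  fix x assume "x \<notin> pverts H'"
  then show "contract e c x = undefined"
    using c by (auto simp: contract_def colorings_iff)
qed

text \<open>A vertex outside \<open>M\<close> with one neighbor in \<open>M\<close> is adjacent to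
  all of \<open>M\<close>.\<close>

lemma module_colors_disjoint:
  assumes "c \<in> colorings H k" "(u, v) \<in> parcs H" "u \<notin> M" "v \<in> M"
  shows "c u \<notin> c ` M"
  using assms module_arc[OF assms(2-4)] by (auto simp: colorings_iff)

text \<open>An optimal coloring of \<open>H\<close> shows at least \<open>card K\<close> colors on
  \<open>M\<close>; handing distinct ones among them to the vertices of \<open>K\<close> colors
  \<open>H'\<close>. Hence a number of colors large enough for \<open>H\<close> is large enough for
  \<open>H'\<close>.\<close>

lemma chromatic_number_contract: "chromatic_number H' \<le> chromatic_number H"
proof -
  obtain c where c: "c \<in> colorings H (chromatic_number H)"
    using colorings_chromatic_number[OF H] by auto
  have "finite (c ` M)" by (simp add: finite_M)
  then obtain e where e: "e ` K \<subseteq> c ` M" "inj_on e K"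
    using card_le_inj[OF finite_K _ chromatic_number_le_card_colors[OF c]] by auto
  have "contract e c \<in> colorings H' (chromatic_number H)"
  proof (rule contract_colorings[OF c e(2)])
    have "c ` M \<subseteq> {1..chromatic_number H}"
      using c M_subset unfolding colorings_iff by blast
    with e(1) show "e ` K \<subseteq> {1..chromatic_number H}"
      by (rule order_trans)
  next
    show "c u \<notin> e ` K" if "(u, v) \<in> parcs H" "u \<notin> M" "v \<in> M" for u v
      using module_colors_disjoint[OF c that] e(1) by blast
  qed
  then show ?thesis by (intro chromatic_number_le) auto
qed

text \<open>The injection \<open>g\<close> carries the colors of H[M] to a palette that no outside
  neighbor of \<open>M\<close> uses, so a recoloring sequence of H[M] can be run inside
  \<open>H\<close> while \<open>c\<close> stays fixed outside \<open>M\<close>.\<close>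

lemma recolor_inside:
  assumes c: "c \<in> colorings H k" and g: "inj_on g {1..j}" "g ` {1..j} \<subseteq> {1..k}"
    and free: "\<And>u v. (u, v) \<in> parcs H \<Longrightarrow> u \<notin> M \<Longrightarrow> v \<in> M \<Longrightarrow> c u \<notin> g ` {1..j}"
    and pq: "(p, q) \<in> (recolor (induced H M) j)\<^sup>*"
  shows "((\<lambda>x. if x \<in> M then g (p x) else c x), (\<lambda>x. if x \<in> M then g (q x) else c x))
    \<in> (recolor H k)\<^sup>*"
  using pq
proof (rule rtrancl_map[where f = "\<lambda>p x. if x \<in> M then g (p x) else c x"])
  let ?f = "\<lambda>p x. if x \<in> M then g (p x) else c x"
  have col: "?f p \<in> colorings H k" if p: "p \<in> colorings (induced H M) j" for p
    unfolding colorings_iff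
  proof (intro conjI allI impI ballI)
    have pj: "p x \<in> {1..j}" if "x \<in> M" for x
      using p that by (auto simp: colorings_iff)
    fix u v assume uv: "(u, v) \<in> parcs H"
    have M: "g (p u) \<noteq> g (p v)" if "u \<in> M" "v \<in> M"
    proof
      assume "g (p u) = g (p v)"
      then have "p u = p v" by (rule inj_onD[OF g(1)]) (rule pj that)+
      with p uv that show False by (simp add: colorings_iff)
    qed
    have "c u \<noteq> g (p v)" if "u \<notin> M" "v \<in> M"
      using free[OF uv that] pj that by auto
    moreover have "c v \<noteq> g (p u)" if "v \<notin> M" "u \<in> M"
      using free[OF pair_graph_sym[OF H uv] that] pj that by auto
    moreover have "c u \<noteq> c v"
      using c uv by (auto simp: colorings_iff)
    ultimately show "?f p u \<noteq> ?f p v"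
      using M by metis
  next
    fix x assume "x \<in> pverts H"
    moreover have "g (p x) \<in> {1..k}" if "x \<in> M"
      using p that g(2) by (fastforce simp: colorings_iff)
    ultimately show "?f p x \<in> {1..k}"
      using c by (auto simp: colorings_iff)
  next
    fix x assume "x \<notin> pverts H"
    then show "?f p x = undefined"
      using c M_subset by (auto simp: colorings_iff)
  qed
  fix p q assume pq: "(p, q) \<in> recolor (induced H M) j"
  show "(?f p, ?f q) \<in> (recolor H k)\<^sup>*"
  proof (rule recolor_independent[OF H])
    fix u v assume uv: "(u, v) \<in> parcs H" and "?f p u \<noteq> ?f q u"
    then have "u \<in> M" "p u \<noteq> q u" by (auto split: if_splits)
    moreover have "\<exists>!x. x \<in> M \<and> p x \<noteq> q x" using pq by (simp add: recolor_iff)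
    ultimately have "v \<in> M \<Longrightarrow> p v = q v"
      using pair_graph_irrefl[OF H uv] by blast
    then show "?f p v = ?f q v" by simp
  qed (use pq in \<open>auto simp: recolor_iff col\<close>)
qed

section \<open>Recolorability passes from H[M] and H' to H\<close>

lemma retract_colorings:
  assumes "c \<in> colorings H k" and "\<And>x. x \<in> M \<Longrightarrow> \<phi> x \<in> K \<and> c x = e (\<phi> x)"
  shows "contract e c \<circ> retract \<phi> = c"
  using assms KM by (auto simp: contract_def retract_def fun_eq_iff)

theorem recolorable_contract:
  assumes rM: "recolorable (induced H M)" and rH': "recolorable H'"
  shows "recolorable H"
  unfolding recolorable_def
proof (intro allI impI)
  fix l assume l: "chromatic_number H + 1 \<le> l"
  have mixH': "mixing H' l"
    using rH' l chromatic_number_contract by (simp add: recolorable_def)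
  have K_mix: "(p, q) \<in> (recolor H' l)\<^sup>*" if "p \<in> colorings H' l" "q \<in> colorings H' l" for p q
    using mixH' that by (simp add: mixing_iff)
  obtain p0 where "p0 \<in> colorings H' (chromatic_number H')"
    using colorings_chromatic_number[OF H'] by auto
  then have p0: "p0 \<in> colorings H' (l - 1)"
    by (rule subsetD[OF colorings_mono, rotated]) (use l chromatic_number_contract in simp)
  then have p0l: "p0 \<in> colorings H' l"
    by (rule subsetD[OF colorings_mono, rotated]) simp
  \<comment> \<open>\<open>b\<close> is the fixed partition of \<open>M\<close> into
    \<open>card K\<close> classes, and \<open>h\<close> names its classes by the vertices of
    \<open>K\<close>.\<close>
  obtain b where b: "b \<in> colorings (induced H M) (card K)"
    using colorings_chromatic_number[OF induced_M] card_K by auto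
  obtain h where h: "bij_betw h {1..card K} K"
    using finite_same_card_bij[of "{1..card K}" K] finite_K by auto
  define \<phi>0 where "\<phi>0 = h \<circ> b"
  have b_mem: "b x \<in> {1..card K}" if "x \<in> M" for x
    using b that by (auto simp: colorings_iff)
  have \<phi>0: "\<phi>0 ` M \<subseteq> K"
    using bij_betwE[OF h] b_mem by (auto simp: \<phi>0_def)
  have \<phi>0_proper: "\<phi>0 u \<noteq> \<phi>0 v" if "(u, v) \<in> parcs H" "u \<in> M" "v \<in> M" for u v
  proof -
    have "b u \<noteq> b v" using that b by (simp add: colorings_iff)
    then show ?thesis
      using inj_onD[OF bij_betw_imp_inj_on[OF h], of "b u" "b v"] b_mem that by (auto simp: \<phi>0_def)
  qed
  interpret hom0: graph_hom H H' "retract \<phi>0"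
    by (rule graph_hom_retract) (use \<phi>0 \<phi>0_proper in auto)
  \<comment> \<open>The common target: \<open>p0\<close> lifted along the fixed partition. It is
    independent of the starting coloring, so reaching it from everywhere proves
    connectedness.\<close>
  define t where "t = p0 \<circ> retract \<phi>0"
  text \<open>With one color more than the minimum available on \<open>M\<close>, the mixing of \<open>H[M]\<close> applies.\<close>
  have spare: "(c, t) \<in> (recolor H l)\<^sup>*"
    if c: "c \<in> colorings H l" and A: "A \<subseteq> {1..l}" "card K + 1 \<le> card A" "c ` M \<subseteq> A"
      and free: "\<And>u v. (u, v) \<in> parcs H \<Longrightarrow> u \<notin> M \<Longrightarrow> v \<in> M \<Longrightarrow> c u \<notin> A" for c A
  proof -
    have finA: "finite A" using A(1) finite_subset by blast
    let ?j = "card A"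
    \<comment> \<open>\<open>g\<close> numbers the palette \<open>A\<close>, so that its inverse
      \<open>g'\<close> turns \<open>c\<close> on \<open>M\<close> into a coloring of H[M] with
      \<open>card A\<close> colors.\<close>
    obtain g where g: "bij_betw g {1..?j} A"
      using finite_same_card_bij[of "{1..?j}" A] finA by auto
    define g' where "g' = the_inv_into {1..?j} g"
    have g': "g' a \<in> {1..?j}" "g (g' a) = a" if "a \<in> A" for a
      using that bij_betwE[OF bij_betw_the_inv_into[OF g]] f_the_inv_into_f_bij_betw[OF g]
      unfolding g'_def by auto
    define p where "p = (\<lambda>x. if x \<in> M then g' (c x) else undefined)"
    have p: "p \<in> colorings (induced H M) ?j"
      unfolding colorings_iff
    proof (intro conjI allI impI ballI)
      fix u v assume uv: "(u, v) \<in> parcs (induced H M)"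
      then have "c u \<noteq> c v" "c u \<in> A" "c v \<in> A"
        using c A(3) by (auto simp: colorings_iff)
      then have "g' (c u) \<noteq> g' (c v)" using g'(2) by metis
      then show "p u \<noteq> p v"
        using uv by (simp add: p_def)
    next
      fix x assume "x \<in> pverts (induced H M)"
      then show "p x \<in> {1..?j}"
        using g'(1) A(3) by (auto simp: p_def)
    qed (auto simp: p_def)
    have q: "b \<in> colorings (induced H M) ?j"
      by (rule subsetD[OF colorings_mono b]) (use A(2) in simp)
    have "mixing (induced H M) ?j"
      using rM A(2) card_K by (simp add: recolorable_def)
    then have pq: "(p, b) \<in> (recolor (induced H M) ?j)\<^sup>*"
      using p q by (simp add: mixing_iff)
    \<comment> \<open>\<open>d\<close> shows the fixed partition on \<open>M\<close> and agrees with
      \<open>c\<close> elsewhere.\<close>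
    define d where "d = (\<lambda>x. if x \<in> M then g (b x) else c x)"
    have "(\<lambda>x. if x \<in> M then g (p x) else c x) = c"
      using A(3) g'(2) by (auto simp: p_def fun_eq_iff)
    moreover have "((\<lambda>x. if x \<in> M then g (p x) else c x), d) \<in> (recolor H l)\<^sup>*"
      unfolding d_def
      by (rule recolor_inside[OF c _ _ _ pq]) (use g A(1) free in \<open>auto simp: bij_betw_def\<close>)
    ultimately have cd: "(c, d) \<in> (recolor H l)\<^sup>*"
      by simp
    \<comment> \<open>\<open>e\<close> gives the clique vertex \<open>h i\<close> the color
      \<open>g i\<close>, which makes \<open>d\<close> the lift of \<open>contract e c\<close>. A
      path in \<open>H'\<close> from there to \<open>p0\<close> then lifts to a path from
      \<open>d\<close> to \<open>t\<close>.\<close>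
    define e where "e = g \<circ> the_inv_into {1..card K} h"
    have "the_inv_into {1..card K} h ` K = {1..card K}"
      using bij_betw_the_inv_into[OF h] by (simp add: bij_betw_def)
    then have inv: "the_inv_into {1..card K} h ` K \<subseteq> {1..?j}"
      using A(2) by simp
    have "inj_on (the_inv_into {1..card K} h) K"
      using h by (metis bij_betw_def inj_on_the_inv_into)
    then have e_inj: "inj_on e K"
      unfolding e_def using g inv by (intro comp_inj_on) (auto simp: bij_betw_def intro: inj_on_subset)
    have e_img: "e ` K \<subseteq> A"
      using inv g by (auto simp: e_def bij_betw_def)
    have e_\<phi>0: "e (\<phi>0 x) = g (b x)" if "x \<in> M" for x
      using b_mem[OF that] h by (simp add: e_def \<phi>0_def bij_betw_def the_inv_into_f_f)
    have col: "contract e c \<in> colorings H' l"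
      by (rule contract_colorings[OF c e_inj]) (use e_img A(1) free in blast)+
    have "contract e c \<circ> retract \<phi>0 = d"
      using e_\<phi>0 \<phi>0 KM by (auto simp: contract_def retract_def d_def fun_eq_iff)
    then have "(d, t) \<in> (recolor H l)\<^sup>*"
      using hom0.recolor_comp[OF K_mix[OF col p0l]] by (simp add: t_def)
    with cd show ?thesis by (rule rtrancl_trans)
  qed
  have main: "(c, t) \<in> (recolor H l)\<^sup>*" if c: "c \<in> colorings H l" for c
  proof (cases "card (c ` M) = card K")
    case False
    \<comment> \<open>Here the colors that \<open>c\<close> shows on \<open>M\<close> already form a
      large enough palette.\<close>
    then have card: "card K + 1 \<le> card (c ` M)"
      using chromatic_number_le_card_colors[OF c] by simp
    have "c ` M \<subseteq> {1..l}"
      using c M_subset by (fastforce simp: colorings_iff)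
    from spare[OF c this card order_refl module_colors_disjoint[OF c]]
    show ?thesis .
  next
    case True
    text \<open>Now \<open>c\<close> factors through \<open>H'\<close>, where it can be recolored so as to free the color \<open>l\<close>.\<close>
    obtain e where e: "bij_betw e K (c ` M)"
      using finite_same_card_bij[of K "c ` M"] finite_K finite_M True by auto
    \<comment> \<open>This retraction follows the color classes of \<open>c\<close> and not the
      fixed partition, so the lifted path ends in \<open>p0 \<circ> retract \<phi>\<close>, which
      need not be \<open>t\<close>.\<close>
    define \<phi> where "\<phi> = the_inv_into K e \<circ> c"
    have \<phi>: "\<phi> x \<in> K" "c x = e (\<phi> x)" if "x \<in> M" for x
      using that e by (auto simp: \<phi>_def bij_betw_def the_inv_into_into f_the_inv_into_f)
    interpret hom: graph_hom H H' "retract \<phi>"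
    proof (rule graph_hom_retract)
      fix u v assume uv: "(u, v) \<in> parcs H" "u \<in> M" "v \<in> M"
      then have "c u \<noteq> c v" using c by (auto simp: colorings_iff)
      with \<phi>(2) uv show "\<phi> u \<noteq> \<phi> v" by metis
    qed (use \<phi> in auto)
    have "contract e c \<in> colorings H' l"
    proof (rule contract_colorings[OF c])
      have "c ` M \<subseteq> {1..l}"
        using c M_subset by (fastforce simp: colorings_iff)
      then show "inj_on e K" "e ` K \<subseteq> {1..l}"
        using e by (auto simp: bij_betw_def)
      show "c u \<notin> e ` K" if "(u, v) \<in> parcs H" "u \<notin> M" "v \<in> M" for u v
        using module_colors_disjoint[OF c that] e by (simp add: bij_betw_def)
    qed
    from hom.recolor_comp[OF K_mix[OF this p0l]]
    have step: "(c, p0 \<circ> retract \<phi>) \<in> (recolor H l)\<^sup>*"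
      using \<phi> by (simp add: retract_colorings[OF c])
    let ?d = "p0 \<circ> retract \<phi>"
    \<comment> \<open>\<open>p0\<close> is injective on the clique \<open>K\<close> and omits
      \<open>l\<close>, so its colors on \<open>K\<close> together with \<open>l\<close> form a
      palette of \<open>card K + 1\<close> colors.\<close>
    have inj: "inj_on p0 K"
      using p0 by (fastforce simp: inj_on_def colorings_iff)
    have range: "p0 ` K \<subseteq> {1..l - 1}"
      using p0 by (fastforce simp: colorings_iff)
    have "l \<notin> p0 ` K"
      using range l by auto
    then have card: "card (insert l (p0 ` K)) = card K + 1"
      using inj finite_K by (simp add: card_image)
    have "(?d, t) \<in> (recolor H l)\<^sup>*"
    proof (rule spare[where A = "insert l (p0 ` K)"])
      show "?d \<in> colorings H l"
        using p0l by (rule hom.colorings_comp)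
      show "insert l (p0 ` K) \<subseteq> {1..l}"
        using range l by (auto dest!: subsetD[OF range imageI])
      show "?d ` M \<subseteq> insert l (p0 ` K)"
        using \<phi> by (auto simp: retract_def)
      \<comment> \<open>An outside neighbor of \<open>M\<close> is adjacent in \<open>H'\<close> to
        all of \<open>K\<close>, so it avoids the colors of \<open>K\<close>; it avoids
        \<open>l\<close> because \<open>p0\<close> does.\<close>
      show "?d u \<notin> insert l (p0 ` K)" if uv: "(u, v) \<in> parcs H" "u \<notin> M" "v \<in> M" for u v
      proof -
        have u: "u \<in> pverts H" using pair_graph_wf[OF H uv(1)] by simp
        then have "p0 u \<in> {1..l - 1}"
          using p0 uv(2) by (auto simp: colorings_iff)
        moreover have "p0 u \<noteq> p0 w" if "w \<in> K" for w
        proof -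
          have "(u, w) \<in> parcs H'"
            using module_arc[OF uv] that KM u uv(2) by auto
          then show ?thesis using p0 unfolding colorings_iff by blast
        qed
        ultimately show ?thesis
          using uv(2) l by (auto simp: retract_def)
      qed
    qed (simp add: card)
    with step show ?thesis by (rule rtrancl_trans)
  qed
  have "t \<in> colorings H l"
    unfolding t_def using p0l by (rule hom0.colorings_comp)
  moreover have "(c, d) \<in> (recolor H l)\<^sup>*" if "c \<in> colorings H l" "d \<in> colorings H l" for c d
    using main[OF that(1)] main[OF that(2)] sym_rtrancl[OF sym_recolor[of H l]]
    by (meson rtrancl_trans symD)
  ultimately show "mixing H l"
    by (auto simp: mixing_iff)
qed

end

section \<open>Simultaneous clique substitution\<close>

text \<open>A closed form for substituting the clique \<open>F v\<close> for every \<open>v\<close>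
  at once. Unlike the inductive \<open>blowup\<close>, it lets modules and induced subgraphs be read
  off from \<open>G\<close>.\<close>

definition expand :: "'a pair_pre_digraph \<Rightarrow> ('a \<Rightarrow> 'a set) \<Rightarrow> 'a pair_pre_digraph" where
  "expand G F =
     \<lparr> pverts = (\<Union>v\<in>pverts G. F v),
       parcs = {(x, y). \<exists>u\<in>pverts G. \<exists>v\<in>pverts G. x \<in> F u \<and> y \<in> F v \<and>
                  (if u = v then x \<noteq> y else (u, v) \<in> parcs G)} \<rparr>"

lemma expand_verts [simp]: "pverts (expand G F) = (\<Union>v\<in>pverts G. F v)"
  by (simp add: expand_def)

definition clique_family :: "'a pair_pre_digraph \<Rightarrow> ('a \<Rightarrow> 'a set) \<Rightarrow> bool" where
  "clique_family G F \<longleftrightarrow> disjoint_family_on F (pverts G) \<and>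
     (\<forall>v\<in>pverts G. finite (F v) \<and> F v \<noteq> {})"

lemma clique_family_inj:
  "clique_family G F \<Longrightarrow> u \<in> pverts G \<Longrightarrow> v \<in> pverts G \<Longrightarrow> x \<in> F u \<Longrightarrow> x \<in> F v \<Longrightarrow> u = v"
  by (auto simp: clique_family_def disjoint_family_on_def)

lemma expand_arc:
  assumes "clique_family G F" "u \<in> pverts G" "v \<in> pverts G" "x \<in> F u" "y \<in> F v"
  shows "(x, y) \<in> parcs (expand G F) \<longleftrightarrow> (if u = v then x \<noteq> y else (u, v) \<in> parcs G)"
proof
  assume "(x, y) \<in> parcs (expand G F)"
  then obtain u' v' where uv': "u' \<in> pverts G" "v' \<in> pverts G" "x \<in> F u'" "y \<in> F v'"
    "if u' = v' then x \<noteq> y else (u', v') \<in> parcs G"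
    by (auto simp: expand_def)
  have "u' = u" "v' = v"
    using clique_family_inj[OF assms(1)] uv'(1-4) assms(2-5) by blast+
  then show "if u = v then x \<noteq> y else (u, v) \<in> parcs G"
    using uv'(5) by (simp only:)
next
  assume "if u = v then x \<noteq> y else (u, v) \<in> parcs G"
  then show "(x, y) \<in> parcs (expand G F)"
    unfolding expand_def pair_pre_digraph.simps mem_Collect_eq prod.case using assms(2-5) by blast
qed

lemma expand_arc_verts:
  "(x, y) \<in> parcs (expand G F) \<Longrightarrow> x \<in> pverts (expand G F) \<and> y \<in> pverts (expand G F)"
  by (auto simp: expand_def)

lemma pair_graph_expand:
  assumes "pair_graph G" "clique_family G F"
  shows "pair_graph (expand G F)"
  unfolding pair_graph_iff
proof (intro conjI)
  show "finite (pverts (expand G F))"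
    using assms by (auto simp: clique_family_def pair_graph_finite)
  show "parcs (expand G F) \<subseteq> pverts (expand G F) \<times> pverts (expand G F)"
    using expand_arc_verts by fastforce
  show "sym (parcs (expand G F))"
    using pair_graph_sym[OF assms(1)] by (fastforce simp: sym_def expand_def split: if_splits)
  show "irrefl (parcs (expand G F))"
    using expand_arc[OF assms(2)] expand_arc_verts
    by (fastforce simp: irrefl_def)
qed

text \<open>Every vertex of an expansion lies in exactly one of the cliques, so arcs can be compared
  for one pair of cliques at a time.\<close>

lemma eq_expandI:
  assumes F: "clique_family G F" and verts: "pverts X = pverts (expand G F)"
    and wf: "\<And>x y. (x, y) \<in> parcs X \<Longrightarrow> x \<in> pverts X \<and> y \<in> pverts X"
    and arcs: "\<And>a b x y. \<lbrakk>a \<in> pverts G; b \<in> pverts G; x \<in> F a; y \<in> F b\<rbrakk> \<Longrightarrow>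
      (x, y) \<in> parcs X \<longleftrightarrow> (if a = b then x \<noteq> y else (a, b) \<in> parcs G)"
  shows "X = expand G F"
proof (rule pair_pre_digraph.equality)
  have "(x, y) \<in> parcs X \<longleftrightarrow> (x, y) \<in> parcs (expand G F)" for x y
  proof (cases "x \<in> pverts X \<and> y \<in> pverts X")
    case True
    then obtain a b where "a \<in> pverts G" "b \<in> pverts G" "x \<in> F a" "y \<in> F b"
      by (auto simp: verts)
    then show ?thesis
      by (simp only: arcs expand_arc[OF F])
  next
    case False
    then show ?thesis
      using wf expand_arc_verts verts by metis
  qed
  then show "parcs X = parcs (expand G F)" by auto
qed (simp_all add: verts)

section \<open>Expansions as successive clique substitutions\<close>

lemma clique_family_singletons: "clique_family G (\<lambda>v. {v})"
  by (auto simp: clique_family_def disjoint_family_on_def)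

lemma expand_singletons: "pair_graph G \<Longrightarrow> expand G (\<lambda>v. {v}) = G"
  by (rule eq_expandI[symmetric]) (auto simp: clique_family_singletons dest: pair_graph_wf pair_graph_irrefl)

lemma expand_cong: "(\<And>v. v \<in> pverts G \<Longrightarrow> F v = F' v) \<Longrightarrow> expand G F = expand G F'"
  by (auto simp: expand_def)

text \<open>Deleting \<open>w\<close> removes the whole clique of \<open>u\<close>. \<open>K\<close>
  may contain \<open>w\<close>, but its other vertices are new, so an old arc at a vertex of
  \<open>K\<close> is an arc at \<open>w\<close>, and the substitution discards it.\<close>

lemma substitute_clique_expand:
  assumes F: "clique_family G F" and F': "clique_family G (F(u := K))"
    and u: "u \<in> pverts G" "F u = {w}"
  shows "substitute_clique (expand G F) w K = expand G (F(u := K))"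
proof (rule eq_expandI[OF F'])
  have w: "w \<notin> F v" if "v \<in> pverts G" "v \<noteq> u" for v
    using clique_family_inj[OF F that(1) u(1)] u(2) that(2) by auto
  have K: "K \<inter> F v = {}" if "v \<in> pverts G" "v \<noteq> u" for v
    using clique_family_inj[OF F' that(1) u(1)] that(2) by auto
  show "pverts (substitute_clique (expand G F) w K) = pverts (expand G (F(u := K)))"
    using w u by (auto simp: substitute_clique_def split: if_splits)
  show "x \<in> pverts (substitute_clique (expand G F) w K) \<and>
      y \<in> pverts (substitute_clique (expand G F) w K)"
    if "(x, y) \<in> parcs (substitute_clique (expand G F) w K)" for x y
    using that by (auto simp: substitute_clique_def dest: expand_arc_verts)
  fix a b x y
  assume ab: "a \<in> pverts G" "b \<in> pverts G" and xy: "x \<in> (F(u := K)) a" "y \<in> (F(u := K)) b"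
  have wu: "w \<in> F u" using u(2) by simp
  have no_loop: "(w, w) \<notin> parcs (expand G F)"
    using expand_arc[OF F u(1) u(1) wu wu] by simp
  consider "a = u" "b = u" | "a = u" "b \<noteq> u" | "a \<noteq> u" "b = u" | "a \<noteq> u" "b \<noteq> u" by blast
  then show "(x, y) \<in> parcs (substitute_clique (expand G F) w K) \<longleftrightarrow>
      (if a = b then x \<noteq> y else (a, b) \<in> parcs G)"
  proof cases
    case 1
    then have "x \<in> K" "y \<in> K" using xy by auto
    moreover have "x = w" if arc: "(x, z) \<in> parcs (expand G F)" for z
    proof -
      obtain c where "c \<in> pverts G" "x \<in> F c"
        using expand_arc_verts[OF arc] by auto
      with K u(2) \<open>x \<in> K\<close> show ?thesis by (cases "c = u") auto
    qed
    moreover have "y = w" if arc: "(z, y) \<in> parcs (expand G F)" for z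
    proof -
      obtain c where "c \<in> pverts G" "y \<in> F c"
        using expand_arc_verts[OF arc] by auto
      with K u(2) \<open>y \<in> K\<close> show ?thesis by (cases "c = u") auto
    qed
    ultimately show ?thesis
      using 1 by (auto simp: substitute_clique_def)
  next
    case 2
    then have "x \<in> K" "y \<in> F b" "y \<notin> K" "y \<noteq> w"
      using xy K[OF ab(2)] w[OF ab(2)] by auto
    moreover have "(x, y) \<notin> parcs (expand G F) \<or> x = w"
    proof (rule ccontr)
      assume *: "\<not> ?thesis"
      then obtain c where "c \<in> pverts G" "x \<in> F c"
        using expand_arc_verts by fastforce
      with K u(2) \<open>x \<in> K\<close> * show False by (cases "c = u") auto
    qed
    ultimately show ?thesis
      using 2 expand_arc[OF F u(1) ab(2) wu] by (auto simp: substitute_clique_def)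
  next
    case 3
    then have "y \<in> K" "x \<in> F a" "x \<notin> K" "x \<noteq> w"
      using xy K[OF ab(1)] w[OF ab(1)] by auto
    moreover have "(x, y) \<notin> parcs (expand G F) \<or> y = w"
    proof (rule ccontr)
      assume *: "\<not> ?thesis"
      then obtain c where "c \<in> pverts G" "y \<in> F c"
        using expand_arc_verts by fastforce
      with K u(2) \<open>y \<in> K\<close> * show False by (cases "c = u") auto
    qed
    ultimately show ?thesis
      using 3 expand_arc[OF F ab(1) u(1) _ wu] by (auto simp: substitute_clique_def)
  next
    case 4
    then have "x \<in> F a" "x \<notin> K" "x \<noteq> w" "y \<in> F b" "y \<notin> K" "y \<noteq> w"
      using xy K[OF ab(1)] w[OF ab(1)] K[OF ab(2)] w[OF ab(2)] by auto
    then show ?thesis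
      using expand_arc[OF F ab] by (auto simp: substitute_clique_def)
  qed
qed

text \<open>The singletons are replaced one vertex of \<open>G\<close> at a time; \<open>X S\<close>
  is the family after treating \<open>S\<close>. As the two families share no vertices, every
  intermediate family is again disjoint.\<close>

lemma blowup_expand_step:
  assumes bl: "blowup G (expand G F)" and F: "clique_family G F" and F': "clique_family G F'"
    and sing: "\<And>v. v \<in> pverts G \<Longrightarrow> is_singleton (F v)"
    and disj: "(\<Union>v\<in>pverts G. F v) \<inter> (\<Union>v\<in>pverts G. F' v) = {}"
    and fin: "finite (pverts G)"
  shows "blowup G (expand G F')"
proof -
  define X where "X S v = (if v \<in> S then F' v else F v)" for S v
  have X: "clique_family G (X S)" for S
    using F F' disj unfolding clique_family_def disjoint_family_on_def X_def
    by (auto; blast)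
  have "blowup G (expand G (X S))" if "S \<subseteq> pverts G" for S
    using finite_subset[OF that fin] that
  proof (induction S rule: finite_induct)
    case empty
    then show ?case using bl by (simp add: X_def[abs_def])
  next
    case (insert u S)
    then have u: "u \<in> pverts G" by simp
    then obtain w where w: "F u = {w}"
      using sing by (auto simp: is_singleton_def)
    have upd: "(X S)(u := F' u) = X (insert u S)"
      by (auto simp: X_def fun_eq_iff)
    have Xw: "X S u = {w}"
      using insert w by (simp add: X_def)
    have "blowup G (substitute_clique (expand G (X S)) w (F' u))"
    proof (rule blowup.substitute)
      show "blowup G (expand G (X S))" using insert by simp
      show "w \<in> pverts (expand G (X S))" using u Xw by auto
      show "finite (F' u)" "F' u \<noteq> {}"
        using F' u by (auto simp: clique_family_def)
      show "F' u \<inter> (pverts (expand G (X S)) - {w}) = {}"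
      proof -
        have "x \<notin> X S v" if "x \<in> F' u" "v \<in> pverts G" "x \<noteq> w" for x v
        proof (cases "v = u")
          case True
          then show ?thesis using Xw that by simp
        next
          case False
          then show ?thesis
            using clique_family_inj[OF X[of "insert u S"] u that(2), of x] that(1)
            by (auto simp: X_def)
        qed
        then show ?thesis by auto
      qed
    qed
    also have "substitute_clique (expand G (X S)) w (F' u) = expand G (X (insert u S))"
      unfolding upd[symmetric]
      by (rule substitute_clique_expand[OF X _ u Xw]) (simp only: upd X)
    finally show ?case .
  qed
  from this[OF order_refl] show ?thesis
    by (simp add: X_def cong: expand_cong)
qed

text \<open>The cliques may reuse vertices of \<open>G\<close>, so the vertices of \<open>G\<close> are first renamed to fresh ones.\<close>
lemma blowup_expand:
  fixes G :: "('a :: infinite) pair_pre_digraph"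
  assumes G: "pair_graph G" and F: "clique_family G F"
  shows "blowup G (expand G F)"
proof -
  have fin: "finite (pverts G)" by (rule pair_graph_finite[OF G])
  \<comment> \<open>\<open>U\<close> collects all names in use; the infinite vertex type leaves room
    outside it for a copy \<open>W\<close> of the vertex set.\<close>
  define U where "U = pverts G \<union> pverts (expand G F)"
  have "finite U"
    using fin pair_graph_finite[OF pair_graph_expand[OF G F]] by (simp add: U_def)
  then have "infinite (- U)"
    using infinite_UNIV by (metis finite_Un Compl_partition)
  then obtain W where W: "W \<subseteq> - U" "finite W" "card W = card (pverts G)"
    using infinite_arbitrarily_large by blast
  then obtain f where f: "bij_betw f (pverts G) W"
    using finite_same_card_bij[OF fin, of W] by auto
  then have fU: "f v \<notin> U" if "v \<in> pverts G" for v
    using W(1) bij_betwE[OF f] that by auto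
  have cf: "clique_family G (\<lambda>v. {f v})"
    using f by (auto simp: clique_family_def disjoint_family_on_def bij_betw_def inj_on_def)
  \<comment> \<open>Starting from \<open>G\<close> as its own expansion by singletons, the first
    round renames the vertices and the second inserts the cliques. In each round the old and new
    names are disjoint.\<close>
  have "blowup G (expand G (\<lambda>v. {f v}))"
    by (rule blowup_expand_step[OF _ clique_family_singletons cf _ _ fin])
      (use fU in \<open>auto simp: expand_singletons[OF G] blowup.refl U_def\<close>)
  then show ?thesis
    by (rule blowup_expand_step[OF _ cf F _ _ fin]) (use fU in \<open>auto simp: U_def\<close>)
qed

section \<open>Modules, induced subgraphs and quotients of expansions\<close>

lemma clique_family_induced:
  "clique_family G F \<Longrightarrow> S \<subseteq> pverts G \<Longrightarrow> clique_family (induced G S) F"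
  unfolding clique_family_def by (auto intro: disjoint_family_on_mono)

lemma expand_induced:
  assumes F: "clique_family G F" and S: "S \<subseteq> pverts G"
  shows "expand (induced G S) F = induced (expand G F) (\<Union>v\<in>S. F v)"
proof (rule eq_expandI[symmetric, OF clique_family_induced[OF F S]])
  fix a b x y
  assume ab: "a \<in> pverts (induced G S)" "b \<in> pverts (induced G S)" and xy: "x \<in> F a" "y \<in> F b"
  then have "a \<in> pverts G" "b \<in> pverts G" using S by auto
  from expand_arc[OF F this xy] ab xy show "(x, y) \<in> parcs (induced (expand G F) (\<Union>v\<in>S. F v)) \<longleftrightarrow>
      (if a = b then x \<noteq> y else (a, b) \<in> parcs (induced G S))"
    by auto
qed auto

text \<open>Adjacency between distinct cliques \<open>F v\<close> and \<open>F s\<close> is that of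
  \<open>v\<close> and \<open>s\<close>, so the module condition carries over from
  \<open>G\<close>.\<close>

lemma graph_module_expand:
  assumes F: "clique_family G F" and S: "graph_module G S"
  shows "graph_module (expand G F) (\<Union>v\<in>S. F v)"
  unfolding graph_module_def
proof (intro conjI ballI)
  have SV: "S \<subseteq> pverts G" using S by (simp add: graph_module_def)
  obtain s where "s \<in> S" using S by (auto simp: graph_module_def)
  moreover then have "F s \<noteq> {}" using F SV by (auto simp: clique_family_def)
  ultimately show "(\<Union>v\<in>S. F v) \<noteq> {}" by auto
  show "(\<Union>v\<in>S. F v) \<subseteq> pverts (expand G F)"
    using SV by auto
  fix x assume "x \<in> pverts (expand G F) - (\<Union>v\<in>S. F v)"
  then obtain v where v: "v \<in> pverts G" "v \<notin> S" "x \<in> F v" by auto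
  have "(x, y) \<in> parcs (expand G F) \<longleftrightarrow> (v, s) \<in> parcs G" if "s \<in> S" "y \<in> F s" for s y
  proof -
    have "s \<in> pverts G" "v \<noteq> s" using that(1) SV v(2) by auto
    then show ?thesis using expand_arc[OF F v(1) _ v(3) that(2)] by simp
  qed
  moreover have "(\<forall>s\<in>S. (v, s) \<in> parcs G) \<or> (\<forall>s\<in>S. (v, s) \<notin> parcs G)"
    using S v by (simp add: graph_module_def)
  ultimately show "(\<forall>s\<in>\<Union>v\<in>S. F v. (x, s) \<in> parcs (expand G F)) \<or>
      (\<forall>s\<in>\<Union>v\<in>S. F v. (x, s) \<notin> parcs (expand G F))"
    by blast
qed

text \<open>One vertex \<open>s\<close> represents the module \<open>S\<close> and receives the
  clique \<open>K\<close>. The vertices of \<open>K\<close> may come from several cliques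
  \<open>F v\<close>, but all \<open>v\<close> in \<open>S\<close> have the same outside neighbors
  as \<open>s\<close>. So shrinking the module gives an expansion of an induced subgraph of
  \<open>G\<close>.\<close>

lemma
  assumes G: "pair_graph G" and F: "clique_family G F" and S: "graph_module G S" and s: "s \<in> S"
    and K: "K \<subseteq> (\<Union>v\<in>S. F v)" "K \<noteq> {}"
  shows clique_family_quotient: "clique_family (induced G (pverts G - S \<union> {s})) (F(s := K))"
    and expand_quotient: "expand (induced G (pverts G - S \<union> {s})) (F(s := K)) =
      replace_module (expand G F) (\<Union>v\<in>S. F v) K"
proof -
  let ?M = "\<Union>v\<in>S. F v"
  have SV: "S \<subseteq> pverts G" using S by (simp add: graph_module_def)
  then have sV: "s \<in> pverts G" using s by auto
  have disj: "F v \<inter> ?M = {}" if "v \<in> pverts G" "v \<notin> S" for v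
    using clique_family_inj[OF F that(1)] that(2) SV by blast
  have "finite ?M"
    using finite_subset[OF SV pair_graph_finite[OF G]] F SV by (auto simp: clique_family_def)
  then have finK: "finite K" using K(1) finite_subset by blast
  have disjK: "K \<inter> F v = {}" if "v \<in> pverts G" "v \<notin> S" for v
    using disj[OF that] K(1) by blast
  have disjF: "F a \<inter> F b = {}" if "a \<in> pverts G" "b \<in> pverts G" "a \<noteq> b" for a b
    using F that by (simp add: clique_family_def disjoint_family_on_def)
  show F': "clique_family (induced G (pverts G - S \<union> {s})) (F(s := K))"
    unfolding clique_family_def disjoint_family_on_def
  proof (intro conjI ballI impI)
    fix a b assume ab: "a \<in> pverts (induced G (pverts G - S \<union> {s}))"
      "b \<in> pverts (induced G (pverts G - S \<union> {s}))" "a \<noteq> b"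
    then consider "a = s" "b \<in> pverts G" "b \<notin> S" | "b = s" "a \<in> pverts G" "a \<notin> S"
      | "a \<noteq> s" "b \<noteq> s" "a \<in> pverts G" "b \<in> pverts G"
      using sV by auto
    then show "(F(s := K)) a \<inter> (F(s := K)) b = {}"
    proof cases
      case 1
      with ab(3) disjK[of b] show ?thesis by simp
    next
      case 2
      with ab(3) disjK[of a] show ?thesis by (simp add: Int_commute)
    next
      case 3
      with ab(3) disjF show ?thesis by simp
    qed
  qed (use F finK K(2) in \<open>auto simp: clique_family_def\<close>)
  have mod: "(a, t) \<in> parcs G \<longleftrightarrow> (a, s) \<in> parcs G"
    if "a \<in> pverts G" "a \<notin> S" "t \<in> S" for a t
    using S that s by (auto simp: graph_module_def)
  then have mod': "(t, a) \<in> parcs G \<longleftrightarrow> (s, a) \<in> parcs G"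
    if "a \<in> pverts G" "a \<notin> S" "t \<in> S" for a t
    using pair_graph_sym[OF G] that by blast
  \<comment> \<open>\<open>a'\<close> is the vertex whose original clique contains \<open>x\<close>:
    some member of \<open>S\<close> if \<open>a = s\<close>, and \<open>a\<close> itself
    otherwise.\<close>
  have mem: "\<exists>a'\<in>pverts G. x \<in> F a' \<and> x \<in> (pverts (expand G F) - ?M) \<union> K \<and>
      (if a = s then a' \<in> S \<and> x \<in> K else a' = a \<and> a \<notin> S \<and> x \<notin> K)"
    if a: "a \<in> pverts (induced G (pverts G - S \<union> {s}))" and x: "x \<in> (F(s := K)) a" for a x
  proof (cases "a = s")
    case True
    with x K(1) SV show ?thesis by auto
  next
    case False
    with a x have *: "a \<in> pverts G" "a \<notin> S" "x \<in> F a" by auto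
    with disj[of a] disjK[of a] have "x \<notin> ?M" "x \<notin> K" by blast+
    with * False show ?thesis by auto
  qed
  show "expand (induced G (pverts G - S \<union> {s})) (F(s := K)) = replace_module (expand G F) ?M K"
  proof (rule eq_expandI[symmetric, OF F'])
    show "pverts (replace_module (expand G F) ?M K) =
        pverts (expand (induced G (pverts G - S \<union> {s})) (F(s := K)))"
      using disj s by (fastforce split: if_splits)
    show "x \<in> pverts (replace_module (expand G F) ?M K) \<and>
        y \<in> pverts (replace_module (expand G F) ?M K)"
      if "(x, y) \<in> parcs (replace_module (expand G F) ?M K)" for x y
      using that by auto
    fix a b x y
    assume a: "a \<in> pverts (induced G (pverts G - S \<union> {s}))" "x \<in> (F(s := K)) a"
      and b: "b \<in> pverts (induced G (pverts G - S \<union> {s}))" "y \<in> (F(s := K)) b"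
    obtain a' where a': "a' \<in> pverts G" "x \<in> F a'" "x \<in> (pverts (expand G F) - ?M) \<union> K"
      "if a = s then a' \<in> S \<and> x \<in> K else a' = a \<and> a \<notin> S \<and> x \<notin> K"
      using mem[OF a] by blast
    obtain b' where b': "b' \<in> pverts G" "y \<in> F b'" "y \<in> (pverts (expand G F) - ?M) \<union> K"
      "if b = s then b' \<in> S \<and> y \<in> K else b' = b \<and> b \<notin> S \<and> y \<notin> K"
      using mem[OF b] by blast
    have iff: "(x, y) \<in> parcs (replace_module (expand G F) ?M K) \<longleftrightarrow>
        (x, y) \<in> parcs (expand G F) \<or> x \<in> K \<and> y \<in> K \<and> x \<noteq> y"
      using a'(3) b'(3) by simp
    have arc: "(x, y) \<in> parcs (expand G F) \<longleftrightarrow> (if a' = b' then x \<noteq> y else (a', b') \<in> parcs G)"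
      by (rule expand_arc[OF F a'(1) b'(1) a'(2) b'(2)])
    have "(x, y) \<in> parcs (replace_module (expand G F) ?M K) \<longleftrightarrow>
        (if a = b then x \<noteq> y else (a, b) \<in> parcs G)"
    proof (cases "a = s")
      case as: True
      show ?thesis
      proof (cases "b = s")
        case True
        have "(x, y) \<in> parcs (expand G F) \<Longrightarrow> x \<noteq> y"
          by (rule pair_graph_irrefl[OF pair_graph_expand[OF G F]])
        with as True iff a'(4) b'(4) show ?thesis by auto
      next
        case False
        with as a'(4) b'(4) have "a' \<in> S" "b' = b" "b \<notin> S" "y \<notin> K" "a' \<noteq> b'" by auto
        then show ?thesis
          unfolding iff arc using as False mod'[of b a'] b'(1) by simp
      qed
    next
      case as: False
      then have a'': "a' = a" "a \<notin> S" "x \<notin> K" using a'(4) by auto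
      show ?thesis
      proof (cases "b = s")
        case True
        with b'(4) a'' have "b' \<in> S" "a' \<noteq> b'" by auto
        then show ?thesis
          unfolding iff arc using as True a'' mod[of a b'] a'(1) by simp
      next
        case False
        with b'(4) have "b' = b" by auto
        then show ?thesis
          unfolding iff arc using a'' by simp
      qed
    qed
    moreover have "(a, b) \<in> parcs (induced G (pverts G - S \<union> {s})) \<longleftrightarrow> (a, b) \<in> parcs G"
      using a(1) b(1) by auto
    ultimately show "(x, y) \<in> parcs (replace_module (expand G F) ?M K) \<longleftrightarrow>
        (if a = b then x \<noteq> y else (a, b) \<in> parcs (induced G (pverts G - S \<union> {s})))"
      by (simp only:)
  qed
qed

section \<open>Induction along non-trivial modules\<close>

theorem recolorable_expand:
  fixes \<G> :: "('a :: infinite) pair_pre_digraph set"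
  assumes graph: "\<And>G. G \<in> \<G> \<Longrightarrow> pair_graph G"
    and hered: "hereditary \<G>"
    and prime: "\<And>G H. \<lbrakk>G \<in> \<G>; prime_graph G; blowup G H\<rbrakk> \<Longrightarrow> recolorable H"
    and "G \<in> \<G>" "clique_family G F"
  shows "recolorable (expand G F)"
  using assms(4,5)
\<comment> \<open>The family varies as well, because the quotient is expanded by
  \<open>F(s := K)\<close>.\<close>
proof (induction "card (pverts G)" arbitrary: G F rule: less_induct)
  case less
  note G = graph[OF less.prems(1)] and F = less.prems(2)
  show ?case
  proof (cases "prime_graph G")
    case True
    with less.prems(1) show ?thesis
      by (rule prime) (rule blowup_expand[OF G F])
  next
    case False
    then obtain S where S: "graph_module G S" "S \<subset> pverts G" "card S \<ge> 2"
      by (auto simp: prime_graph_def nontrivial_module_def)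
    have finG: "finite (pverts G)" by (rule pair_graph_finite[OF G])
    have SV: "S \<subseteq> pverts G" using S(2) by auto
    define M where "M = (\<Union>v\<in>S. F v)"
    have M: "graph_module (expand G F) M"
      unfolding M_def using F S(1) by (rule graph_module_expand)
    note H = pair_graph_expand[OF G F]
    have HM: "pair_graph (induced (expand G F) M)"
      by (rule pair_graph_induced[OF H]) (use M in \<open>simp add: graph_module_def\<close>)
    let ?\<chi> = "chromatic_number (induced (expand G F) M)"
    have "?\<chi> \<le> card M"
      using chromatic_number_le_card_image[OF HM, of "\<lambda>x. x"] pair_graph_irrefl[OF HM] by simp
    then obtain K where K: "K \<subseteq> M" "card K = ?\<chi>"
      by (rule obtain_subset_with_card_n)
    \<comment> \<open>\<open>K\<close> has to be non-empty to be the clique of a vertex.\<close>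
    have "?\<chi> \<noteq> 0"
    proof
      assume "?\<chi> = 0"
      with colorings_chromatic_number[OF HM] have "M = {}"
        by (auto simp: colorings_iff)
      with M show False by (simp add: graph_module_def)
    qed
    with K(2) have K_ne: "K \<noteq> {}" by auto
    obtain s where s: "s \<in> S" using S(1) by (auto simp: graph_module_def)
    let ?T = "pverts G - S \<union> {s}"
    have TV: "?T \<subseteq> pverts G" using s SV by auto
    \<comment> \<open>\<open>S\<close> has a second vertex, so keeping only \<open>s\<close> of it
      makes the graph smaller.\<close>
    have "\<not> S \<subseteq> {s}"
      using S(3) card_mono[of "{s}" S] by auto
    then have T: "?T \<subset> pverts G" using SV TV by auto
    have inner: "recolorable (expand (induced G S) F)"
    proof (rule less.hyps)
      show "card (pverts (induced G S)) < card (pverts G)"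
        using psubset_card_mono[OF finG S(2)] by simp
    qed (use hereditary_induced[OF hered less.prems(1) G SV] clique_family_induced[OF F SV] in auto)
    have quotient: "recolorable (expand (induced G ?T) (F(s := K)))"
    proof (rule less.hyps)
      show "card (pverts (induced G ?T)) < card (pverts G)"
        using psubset_card_mono[OF finG T] by simp
      show "induced G ?T \<in> \<G>"
        by (rule hereditary_induced[OF hered less.prems(1) G TV])
      show "clique_family (induced G ?T) (F(s := K))"
        by (rule clique_family_quotient[OF G F S(1) s]) (use K(1) K_ne in \<open>simp_all add: M_def\<close>)
    qed
    interpret clique_contraction "expand G F" M K
      using H M K by (rule clique_contraction.intro)
    show ?thesis
    proof (rule recolorable_contract)
      show "recolorable (induced (expand G F) M)"
        using inner by (simp only: expand_induced[OF F SV] M_def)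
      show "recolorable (replace_module (expand G F) M K)"
        using quotient by (simp only: expand_quotient[OF G F S(1) s K(1)[unfolded M_def] K_ne] M_def)
    qed
  qed
qed

theorem theorem3:
  fixes \<G> :: "('a :: infinite) pair_pre_digraph set"
  assumes "\<And>G. G \<in> \<G> \<Longrightarrow> pair_graph G"
    and "hereditary \<G>"
    and "\<And>G H. \<lbrakk>G \<in> \<G>; prime_graph G; blowup G H\<rbrakk> \<Longrightarrow> recolorable H"
  shows "\<forall>G\<in>\<G>. recolorable G"
proof
  fix G assume G: "G \<in> \<G>"
  \<comment> \<open>\<open>G\<close> is its own expansion by singletons.\<close>
  have "recolorable (expand G (\<lambda>v. {v}))"
    by (rule recolorable_expand[OF assms G clique_family_singletons])
  then show "recolorable G"
    by (simp add: expand_singletons[OF assms(1)[OF G]])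
qed

end
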